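(* Let $k\ge3$ be an integer and let $$H_0=z_k\,(z_{2k+1}-z_k\,z_{k+1})^2-z_{k+2}^3 ,$$ regarded as a contact Hamiltonian on $\mathbb R^{2k+1}$ with coordinates $z_1,\dots,z_{2k+1}$. The minimal resonant set $\mathfrak S$ of $H_0$, for polynomials in the variables $z_k,z_{k+1},\dots,z_{2k-1},z_{2k+1}$, corresponding to the lexicographical order determined by $z_{2k+1}\succ z_k\succ z_{k+1}\succ\dots\succ z_{2k-1}$, consists of the following monomials: (i) $z_k^{i_k}\,z_{k+1}^{i_{k+1}}\cdots z_{2k-1}^{i_{2k-1}}$; (ii) $z_{2k+1}\,z_k^{i_k+1}\,z_{k+j}$ with $j=1,\dots,k-1$, and $z_{2k+1}^3\,z_k^{i_k+1}$; (iii) $z_{2k+1}^{i_{2k+1}}\,z_{k+1}^{i_{k+1}}\cdots z_{2k-1}^{i_{2k-1}}$, except $z_{2k+1}\,z_{k+2}^3$; where $i_{2k+1},i_k,i_{k+1},\dots,i_{2k-1}$ range over $\mathbb Z_+$ (nonnegative integers).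
   Context: The contact Poisson bracket on $\mathbb R^{2k+1}$ (contact form $dz_{2k+1}-\sum_{i=1}^k z_{k+i}\,dz_i$) is $$\{\Phi,\Psi\}=\Phi\frac{\partial\Psi}{\partial z_{2k+1}}-\Psi\frac{\partial\Phi}{\partial z_{2k+1}}+\sum_{i=1}^k\Big(\frac{\partial\Phi}{\partial z_i}+z_{k+i}\frac{\partial\Phi}{\partial z_{2k+1}}\Big)\frac{\partial\Psi}{\partial z_{k+i}}-\Big(\frac{\partial\Psi}{\partial z_i}+z_{k+i}\frac{\partial\Psi}{\partial z_{2k+1}}\Big)\frac{\partial\Phi}{\partial z_{k+i}}.$$ Here $z_k$ plays the role of temperature, $z_{k+1},\dots,z_{2k-1}$ of (linear combinations of) concentrations, $z_{2k+1}$ of pressure, while $z_1,\dots,z_{k-1}$ (chemical potentials) and $z_{2k}$ (entropy density) do not enter a thermal equation of state. Accordingly only polynomials in the ring $A=\mathbb R[z_k,z_{k+1},\dots,z_{2k-1},z_{2k+1}]$ are considered, both for perturbations and for generating functions of transformations; $\{H_0,\cdot\}$ maps $A$ to itself. $H_0$ is quasi-homogeneous of generalized degree $9$ for the weight $\gamma=(1,\dots,1,3,\dots,3,4)$ ($z_1,\dots,z_k$ of weight $1$; $z_{k+1},\dots,z_{2k}$ of weight $3$; $z_{2k+1}$ of weight $4$), meaning that all its monomials have weighted degree $9$. The minimal resonant set corresponding to a monomial order $\succ$ is the set of all monomials of $A$ that are not the leading (i.e. $\succ$-greatest) monomial of any nonzero polynomial of the form $\{H_0,F\}$ with $F\in A$.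 *)

theory Defs
  imports Complex_Main "HOL-Library.Poly_Mapping"
begin

text \<open>A monomial is represented by its exponent vector, a polynomial by its finitely supported
  coefficient function; multiplication of polynomials is the convolution product of
  \<^theory>\<open>HOL-Library.Poly_Mapping\<close>. The coordinates are indexed from 1.\<close>

type_synonym monom = "nat \<Rightarrow>\<^sub>0 nat"
type_synonym rpoly = "monom \<Rightarrow>\<^sub>0 real"

definition monom_poly :: "monom \<Rightarrow> rpoly" where
  "monom_poly m = Poly_Mapping.single m 1"

definition z :: "nat \<Rightarrow> rpoly" where
  "z i = monom_poly (Poly_Mapping.single i 1)"

text \<open>The subtraction of exponents is truncated, but it truncates only where the coefficient
  vanishes.\<close>

definition pdiff :: "nat \<Rightarrow> rpoly \<Rightarrow> rpoly" where
  "pdiff i p = (\<Sum>m\<in>Poly_Mapping.keys p.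
     Poly_Mapping.single (m - Poly_Mapping.single i 1)
       (real (Poly_Mapping.lookup m i) * Poly_Mapping.lookup p m))"

text \<open>The contact form is \<open>dz\<^sub>2\<^sub>k\<^sub>+\<^sub>1 - (\<Sum>i=1..k. z\<^sub>k\<^sub>+\<^sub>i dz\<^sub>i)\<close>.\<close>

definition contact_bracket :: "nat \<Rightarrow> rpoly \<Rightarrow> rpoly \<Rightarrow> rpoly" where
  "contact_bracket k \<Phi> \<Psi> =
     \<Phi> * pdiff (2*k+1) \<Psi> - \<Psi> * pdiff (2*k+1) \<Phi>
     + (\<Sum>i=1..k. (pdiff i \<Phi> + z (k+i) * pdiff (2*k+1) \<Phi>) * pdiff (k+i) \<Psi>
                 - (pdiff i \<Psi> + z (k+i) * pdiff (2*k+1) \<Psi>) * pdiff (k+i) \<Phi>)"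

definition eos_vars :: "nat \<Rightarrow> nat set" where
  "eos_vars k = {k..2*k-1} \<union> {2*k+1}"

definition monoms_in :: "nat set \<Rightarrow> monom set" where
  "monoms_in V = {m. Poly_Mapping.keys m \<subseteq> V}"

definition polys_in :: "nat set \<Rightarrow> rpoly set" where
  "polys_in V = {p. Poly_Mapping.keys p \<subseteq> monoms_in V}"

text \<open>\<open>lex_greater vs m n\<close> means that \<open>m\<close> is strictly greater than \<open>n\<close>; the list \<open>vs\<close>
  enumerates the variables, the greatest one first.\<close>

definition lex_greater :: "nat list \<Rightarrow> monom \<Rightarrow> monom \<Rightarrow> bool" where
  "lex_greater vs m n \<longleftrightarrow>
     (\<exists>j<length vs.
        (\<forall>i<j. Poly_Mapping.lookup m (vs ! i) = Poly_Mapping.lookup n (vs ! i)) \<and>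
        Poly_Mapping.lookup m (vs ! j) > Poly_Mapping.lookup n (vs ! j))"

definition is_leading_monom :: "(monom \<Rightarrow> monom \<Rightarrow> bool) \<Rightarrow> monom \<Rightarrow> rpoly \<Rightarrow> bool" where
  "is_leading_monom gt m p \<longleftrightarrow>
     m \<in> Poly_Mapping.keys p \<and> (\<forall>n\<in>Poly_Mapping.keys p. n \<noteq> m \<longrightarrow> gt m n)"

definition minimal_resonant_set :: "nat \<Rightarrow> (monom \<Rightarrow> monom \<Rightarrow> bool) \<Rightarrow> rpoly \<Rightarrow> rpoly set" where
  "minimal_resonant_set k gt H =
     {monom_poly m | m. m \<in> monoms_in (eos_vars k) \<and>
        \<not> (\<exists>F\<in>polys_in (eos_vars k).
              contact_bracket k H F \<noteq> 0 \<and> is_leading_monom gt m (contact_bracket k H F))}"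

text \<open>The order \<open>z\<^sub>2\<^sub>k\<^sub>+\<^sub>1 \<succ> z\<^sub>k \<succ> z\<^sub>k\<^sub>+\<^sub>1 \<succ> \<dots> \<succ> z\<^sub>2\<^sub>k\<^sub>-\<^sub>1\<close>; the interval is half-open.\<close>

definition eos_lex :: "nat \<Rightarrow> monom \<Rightarrow> monom \<Rightarrow> bool" where
  "eos_lex k = lex_greater ((2*k+1) # [k..<2*k])"

definition H0 :: "nat \<Rightarrow> rpoly" where
  "H0 k = z k * (z (2*k+1) - z k * z (k+1))^2 - z (k+2)^3"

end

theory Submission
  imports Defs
begin

text \<open>
  Write \<open>x = z\<^sub>k\<close>, \<open>p = z\<^sub>2\<^sub>k\<^sub>+\<^sub>1\<close>, \<open>a\<^sub>j = z\<^sub>k\<^sub>+\<^sub>j\<close>, \<open>a = a\<^sub>1\<close>, \<open>b = a\<^sub>2\<close>, so that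
  \<open>H\<^sub>0 = x (p - x a)\<^sup>2 - b\<^sup>3\<close>. On polynomials in these variables the coordinates conjugate to the
  \<open>a\<^sub>j\<close> and to \<open>x\<close> do not occur, and the bracket becomes the operator
  \<open>L F = 2 x (p - x a) (E F - F) + (x (p\<^sup>2 - x\<^sup>2 a\<^sup>2) + 2 b\<^sup>3) \<partial>F/\<partial>p\<close>, where \<open>E\<close> is the Euler field
  of the concentrations \<open>a\<^sub>j\<close> (\<open>contact_bracket_H0\<close>). It contains no derivative in \<open>x\<close>, hence
  is linear over the polynomials in \<open>x\<close>.

  On a monomial \<open>t\<close> of degree \<open>d\<close> in the concentrations and degree \<open>n\<close> in \<open>p\<close>, every term of
  \<open>L t\<close> has degree at most \<open>n\<close> in \<open>p\<close>, apart from \<open>(2 d - 2 + n) x p t\<close>. So \<open>x p t\<close> is the leading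
  monomial unless \<open>2 d + n = 2\<close>. The exceptions are \<open>x\<^sup>i a\<^sub>j\<close>, which \<open>L\<close> annihilates, and
  \<open>x\<^sup>i p\<^sup>2\<close>. For the latter, replace \<open>p\<^sup>2\<close> by the square \<open>Q = (p - x a)\<^sup>2\<close>, from which it differs by
  regular monomials. As \<open>L H\<^sub>0 = 0\<close>, the product \<open>x Q\<close> is congruent to the regular monomial
  \<open>b\<^sup>3\<close> modulo the kernel, and only constant multiples of \<open>Q\<close> itself remain. Therefore every
  image is of the form \<open>L G + c L Q\<close> with all monomials of \<open>G\<close> regular and \<open>c\<close> constant
  (\<open>reduce_to_regular\<close>).

  Since \<open>t \<mapsto> x p t\<close> is strictly increasing, \<open>L G\<close> has the leading monomial \<open>x p s\<close>, where
  \<open>s\<close> is the greatest monomial of \<open>G\<close> (\<open>leading_monom_regular\<close>). The additional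
  \<open>L Q = 4 b\<^sup>3 (p - x a)\<close> does not interfere: its leading monomial \<open>p b\<^sup>3\<close> is free of \<open>x\<close> and linear
  in \<open>p\<close>, so it is smaller than any multiple of \<open>x p\<close>. The leading monomials of the image are
  consequently the \<open>x p s\<close> with \<open>s\<close> regular together with \<open>p b\<^sup>3\<close>
  (\<open>leading_monom_image_iff\<close>). The resonant set is the complement: the monomials free of \<open>p\<close>,
  the monomials free of \<open>x\<close> except \<open>p b\<^sup>3\<close>, and the two families \<open>x\<^sup>i\<^sup>+\<^sup>1 p a\<^sub>j\<close> and \<open>x\<^sup>i\<^sup>+\<^sup>1 p\<^sup>3\<close>
  obtained from the non-regular monomials.
\<close>

section \<open>Polynomials as sums of monomials\<close>

lemma poly_mapping_eq_sum_single:
  "F = (\<Sum>m\<in>Poly_Mapping.keys F. Poly_Mapping.single m (Poly_Mapping.lookup F m))"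
  by (rule poly_mapping_eqI)
    (auto simp: lookup_sum lookup_single when_def in_keys_iff sum.delta)

lemma poly_mapping_additive_induct [consumes 1, case_names zero single add]:
  fixes F :: "'a \<Rightarrow>\<^sub>0 'b::comm_monoid_add"
  assumes "Poly_Mapping.keys F \<subseteq> M"
    and "P 0"
    and "\<And>m c. m \<in> M \<Longrightarrow> P (Poly_Mapping.single m c)"
    and "\<And>f g. P f \<Longrightarrow> P g \<Longrightarrow> P (f + g)"
  shows "P F"
proof -
  have "P (\<Sum>m\<in>A. Poly_Mapping.single m (Poly_Mapping.lookup F m))" if "A \<subseteq> M" "finite A" for A
    using that(2,1) by (induction A) (auto intro: assms)
  from this[OF assms(1)] show ?thesis
    by (subst poly_mapping_eq_sum_single) simp
qed

lemma keys_sum_subset: "Poly_Mapping.keys (\<Sum>i\<in>I. f i) \<subseteq> (\<Union>i\<in>I. Poly_Mapping.keys (f i))"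
proof (induction I rule: infinite_finite_induct)
  case (insert i I)
  then show ?case using keys_add[of "f i" "sum f I"] by auto
qed auto

lemma monom_poly_add: "monom_poly (m + n) = monom_poly m * monom_poly n"
  by (simp add: monom_poly_def mult_single)

lemma monom_poly_inject: "monom_poly m = monom_poly n \<longleftrightarrow> m = n"
  by (metis monom_poly_def lookup_single_eq lookup_single_not_eq zero_neq_one)

lemma z_power: "z i ^ n = monom_poly (Poly_Mapping.single i n)"
proof (induction n)
  case 0
  then show ?case by (simp add: monom_poly_def)
next
  case (Suc n)
  have "Poly_Mapping.single i (Suc n) = Poly_Mapping.single i 1 + Poly_Mapping.single i n"
    by (simp flip: single_add)
  with Suc show ?case by (simp add: z_def monom_poly_add)
qed

lemma z_power_mult_single:
  "z i ^ j * Poly_Mapping.single m c = Poly_Mapping.single (m + Poly_Mapping.single i j) c"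
  by (simp add: z_power monom_poly_def mult_single add.commute)

lemma z_mult_single:
  "z i * Poly_Mapping.single m c = Poly_Mapping.single (m + Poly_Mapping.single i 1) c"
  using z_power_mult_single[of i 1] by simp

lemma monom_poly_eq_prod:
  assumes "finite V" "m \<in> monoms_in V"
  shows "monom_poly m = (\<Prod>l\<in>V. z l ^ Poly_Mapping.lookup m l)"
proof -
  have "(\<Prod>l\<in>V. z l ^ Poly_Mapping.lookup m l)
      = monom_poly (\<Sum>l\<in>V. Poly_Mapping.single l (Poly_Mapping.lookup m l))"
    using assms(1) by (induction V) (auto simp: z_power monom_poly_def mult_single)
  also have "(\<Sum>l\<in>V. Poly_Mapping.single l (Poly_Mapping.lookup m l)) = m"
    using assms
    by (intro poly_mapping_eqI)
      (auto simp: monoms_in_def lookup_sum lookup_single when_def in_keys_iff sum.delta)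
  finally show ?thesis by simp
qed

lemma prod_eq_monom_poly:
  fixes i :: "nat \<Rightarrow> nat"
  assumes "finite V"
  obtains m where "m \<in> monoms_in V" "\<And>l. Poly_Mapping.lookup m l = (if l \<in> V then i l else 0)"
    "(\<Prod>l\<in>V. z l ^ i l) = monom_poly m"
proof -
  define m where "m = (\<Sum>l\<in>V. Poly_Mapping.single l (i l))"
  have lookup: "Poly_Mapping.lookup m l = (if l \<in> V then i l else 0)" for l
    using assms by (auto simp: m_def lookup_sum lookup_single when_def sum.delta)
  then have mem: "m \<in> monoms_in V"
    by (auto simp: monoms_in_def in_keys_iff split: if_splits)
  have "(\<Prod>l\<in>V. z l ^ i l) = monom_poly m"
    by (subst monom_poly_eq_prod[OF assms mem]) (auto simp: lookup intro: prod.cong)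
  with lookup mem show ?thesis using that by blast
qed

section \<open>Partial derivatives\<close>

lemma pdiff_superset:
  assumes "finite A" "Poly_Mapping.keys p \<subseteq> A"
  shows "pdiff i p = (\<Sum>m\<in>A. Poly_Mapping.single (m - Poly_Mapping.single i 1)
       (real (Poly_Mapping.lookup m i) * Poly_Mapping.lookup p m))"
  unfolding pdiff_def using assms
  by (intro sum.mono_neutral_left) (auto simp: in_keys_iff)

lemma pdiff_single:
  "pdiff i (Poly_Mapping.single m c)
    = Poly_Mapping.single (m - Poly_Mapping.single i 1) (real (Poly_Mapping.lookup m i) * c)"
  by (auto simp: pdiff_def)

lemma pdiff_zero [simp]: "pdiff i 0 = 0"
  by (simp add: pdiff_def)

lemma pdiff_add: "pdiff i (f + g) = pdiff i f + pdiff i g"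
proof -
  let ?A = "Poly_Mapping.keys f \<union> Poly_Mapping.keys g"
  have "Poly_Mapping.keys (f + g) \<subseteq> ?A" by (rule keys_add)
  then show ?thesis
    by (simp add: pdiff_superset[of ?A] sum.distrib[symmetric] lookup_add distrib_left
        flip: single_add)
qed

lemma pdiff_minus: "pdiff i (f - g) = pdiff i f - pdiff i g"
  using pdiff_add[of i "f - g" g] by (simp add: algebra_simps)

text \<open>The truncated subtraction of exponents is harmless here: where it truncates, the factor
  \<open>m\<^sub>i\<close> or \<open>n\<^sub>i\<close> in front vanishes.\<close>

lemma pdiff_mult_single:
  "pdiff i (Poly_Mapping.single m c * Poly_Mapping.single n d)
    = pdiff i (Poly_Mapping.single m c) * Poly_Mapping.single n d
      + Poly_Mapping.single m c * pdiff i (Poly_Mapping.single n d)"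
proof -
  let ?e = "Poly_Mapping.single i (1::nat)"
  have 1: "Poly_Mapping.lookup m i = 0 \<or> m - ?e + n = m + n - ?e"
    by (auto intro!: poly_mapping_eqI simp: lookup_add lookup_minus lookup_single when_def)
  have 2: "Poly_Mapping.lookup n i = 0 \<or> m + (n - ?e) = m + n - ?e"
    by (auto intro!: poly_mapping_eqI simp: lookup_add lookup_minus lookup_single when_def)
  from 1 2 show ?thesis
    by (auto simp: pdiff_single mult_single lookup_add algebra_simps simp flip: single_add)
qed

lemma pdiff_mult: "pdiff i (f * g) = pdiff i f * g + f * pdiff i g"
proof (induction f rule: poly_mapping_additive_induct[OF subset_UNIV])
  case (2 m c)
  show ?case
    by (induction g rule: poly_mapping_additive_induct[OF subset_UNIV])
      (simp_all add: pdiff_mult_single pdiff_add algebra_simps)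
qed (simp_all add: pdiff_add algebra_simps)

lemma pdiff_z: "pdiff i (z j) = (if i = j then 1 else 0)"
  by (auto simp: z_def monom_poly_def pdiff_single lookup_single when_def)

lemma z_mult_pdiff_single:
  "z i * pdiff i (Poly_Mapping.single m c)
    = Poly_Mapping.single m (real (Poly_Mapping.lookup m i) * c)"
proof -
  have "Poly_Mapping.lookup m i = 0 \<or> m - Poly_Mapping.single i 1 + Poly_Mapping.single i 1 = m"
    by (auto intro!: poly_mapping_eqI simp: lookup_add lookup_minus lookup_single when_def)
  then show ?thesis by (auto simp: pdiff_single z_mult_single)
qed

section \<open>The lexicographic order\<close>

lemma transp_lex_greater: "transp (lex_greater vs)"
proof (rule transpI)
  fix a b c assume "lex_greater vs a b" "lex_greater vs b c"
  then obtain j j' where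
    j: "j < length vs" "\<forall>i<j. Poly_Mapping.lookup a (vs ! i) = Poly_Mapping.lookup b (vs ! i)"
      "Poly_Mapping.lookup a (vs ! j) > Poly_Mapping.lookup b (vs ! j)" and
    j': "j' < length vs" "\<forall>i<j'. Poly_Mapping.lookup b (vs ! i) = Poly_Mapping.lookup c (vs ! i)"
      "Poly_Mapping.lookup b (vs ! j') > Poly_Mapping.lookup c (vs ! j')"
    unfolding lex_greater_def by blast
  show "lex_greater vs a c"
    unfolding lex_greater_def using j j'
    by (cases j j' rule: linorder_cases) (auto intro!: exI[of _ "min j j'"])
qed

lemma lex_greater_irrefl: "\<not> lex_greater vs m m"
  by (simp add: lex_greater_def)

lemma lex_greater_asym: "lex_greater vs m n \<Longrightarrow> \<not> lex_greater vs n m"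
  using transpD[OF transp_lex_greater, of vs m n m] lex_greater_irrefl by blast

lemma lex_greater_total:
  assumes "m \<in> monoms_in (set vs)" "n \<in> monoms_in (set vs)" "m \<noteq> n"
  shows "lex_greater vs m n \<or> lex_greater vs n m"
proof -
  define P where "P j \<longleftrightarrow>
    j < length vs \<and> Poly_Mapping.lookup m (vs ! j) \<noteq> Poly_Mapping.lookup n (vs ! j)" for j
  have "\<exists>j. P j"
  proof (rule ccontr)
    assume *: "\<not> ?thesis"
    have "Poly_Mapping.lookup m l = Poly_Mapping.lookup n l" for l
    proof (cases "l \<in> set vs")
      case True
      with * show ?thesis by (auto simp: P_def in_set_conv_nth)
    next
      case False
      then have "l \<notin> Poly_Mapping.keys m" "l \<notin> Poly_Mapping.keys n"
        using assms(1,2) by (auto simp: monoms_in_def)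
      then show ?thesis by (simp add: in_keys_iff)
    qed
    with assms(3) show False by (auto intro: poly_mapping_eqI)
  qed
  then obtain j where j: "P j" and least: "\<And>i. i < j \<Longrightarrow> \<not> P i"
    using exists_least_iff[of P] by blast
  have "\<forall>i<j. Poly_Mapping.lookup m (vs ! i) = Poly_Mapping.lookup n (vs ! i)"
    using j least unfolding P_def by (meson less_trans)
  with j show ?thesis
    unfolding P_def lex_greater_def by (metis linorder_neqE_nat)
qed

lemma lex_greater_add_right: "lex_greater vs (m + r) (n + r) \<longleftrightarrow> lex_greater vs m n"
  by (simp add: lex_greater_def lookup_add)

section \<open>The bracket as an operator on equations of state\<close>

definition conc_euler :: "nat \<Rightarrow> rpoly \<Rightarrow> rpoly" where
  "conc_euler k F = (\<Sum>i=1..<k. z (k+i) * pdiff (k+i) F)"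

definition conc_degree :: "nat \<Rightarrow> monom \<Rightarrow> nat" where
  "conc_degree k m = (\<Sum>i=1..<k. Poly_Mapping.lookup m (k+i))"

text \<open>The operator \<open>L\<close> of the introduction.\<close>

definition eos_operator :: "nat \<Rightarrow> rpoly \<Rightarrow> rpoly" where
  "eos_operator k F =
     2 * z k * (z (2*k+1) - z k * z (k+1)) * (conc_euler k F - F)
     + (z k * (z (2*k+1)^2 - (z k * z (k+1))^2) + 2 * z (k+2)^3) * pdiff (2*k+1) F"

lemma conc_euler_add: "conc_euler k (f + g) = conc_euler k f + conc_euler k g"
  by (simp add: conc_euler_def pdiff_add distrib_left sum.distrib)

lemma conc_euler_minus: "conc_euler k (f - g) = conc_euler k f - conc_euler k g"
  by (simp add: conc_euler_def pdiff_minus right_diff_distrib sum_subtractf)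

lemma conc_euler_mult: "conc_euler k (f * g) = conc_euler k f * g + f * conc_euler k g"
  by (simp add: conc_euler_def pdiff_mult sum.distrib[symmetric] sum_distrib_left
      sum_distrib_right algebra_simps)

lemma conc_euler_single:
  "conc_euler k (Poly_Mapping.single m c) = Poly_Mapping.single m (real (conc_degree k m) * c)"
proof -
  have "(\<Sum>i\<in>I. Poly_Mapping.single m (g i)) = Poly_Mapping.single m (\<Sum>i\<in>I. g i)"
    if "finite I" for I :: "nat set" and g :: "nat \<Rightarrow> real"
    using that by (induction I) (auto simp: single_add)
  then show ?thesis
    by (simp add: conc_euler_def conc_degree_def z_mult_pdiff_single sum_distrib_right)
qed

lemma conc_degree_single:
  "conc_degree k (Poly_Mapping.single j n) = (if k < j \<and> j < 2*k then n else 0)"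
proof -
  have "conc_degree k (Poly_Mapping.single j n) = (\<Sum>i=1..<k. if k + i = j then n else 0)"
    unfolding conc_degree_def by (intro sum.cong) (auto simp: lookup_single when_def)
  also have "\<dots> = (\<Sum>i=1..<k. if i = j - k then (if k < j then n else 0) else 0)"
    by (intro sum.cong) auto
  also have "\<dots> = (if k < j \<and> j < 2*k then n else 0)"
    by (auto simp: sum.delta)
  finally show ?thesis .
qed

lemma conc_degree_add: "conc_degree k (m + n) = conc_degree k m + conc_degree k n"
  by (simp add: conc_degree_def lookup_add sum.distrib)

lemma conc_euler_z: "conc_euler k (z j) = (if k < j \<and> j < 2*k then z j else 0)"
  by (simp add: z_def monom_poly_def conc_euler_single conc_degree_single)

lemma pdiff_const: "pdiff i (Poly_Mapping.single 0 c) = 0"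
  by (simp add: pdiff_single)

lemma conc_euler_const: "conc_euler k (Poly_Mapping.single 0 c) = 0"
  by (simp add: conc_euler_def pdiff_const)

lemma pdiff_numeral: "pdiff i (numeral n) = 0"
  by (metis pdiff_const single_numeral)

lemma conc_euler_numeral: "conc_euler k (numeral n) = 0"
  by (metis conc_euler_const single_numeral)

lemmas derivation_simps =
  pdiff_add pdiff_minus pdiff_mult pdiff_z pdiff_numeral
  conc_euler_add conc_euler_minus conc_euler_mult conc_euler_z conc_euler_numeral
  power2_eq_square power3_eq_cube

lemma pdiff_outside:
  assumes "F \<in> polys_in V" "i \<notin> V"
  shows "pdiff i F = 0"
proof -
  have "Poly_Mapping.lookup m i = 0" if "m \<in> Poly_Mapping.keys F" for m
  proof -
    have "i \<notin> Poly_Mapping.keys m" using that assms by (auto simp: polys_in_def monoms_in_def)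
    then show ?thesis by (simp add: in_keys_iff)
  qed
  then show ?thesis by (simp add: pdiff_def)
qed

text \<open>In the sum over conjugate pairs, the term \<open>i = k\<close> vanishes because neither \<open>F\<close> nor \<open>H\<^sub>0\<close>
  depends on \<open>z\<^sub>2\<^sub>k\<close>, and in the terms \<open>i < k\<close> only the parts with the factor \<open>z\<^sub>k\<^sub>+\<^sub>i\<close> survive;
  these add up to Euler fields. This gives
  \<open>{H\<^sub>0, F} = \<partial>\<^sub>pH\<^sub>0 (E F - F) + (H\<^sub>0 - E H\<^sub>0) \<partial>\<^sub>pF\<close>.\<close>

lemma contact_bracket_H0:
  assumes "k \<ge> 3" and F: "F \<in> polys_in (eos_vars k)"
  shows "contact_bracket k (H0 k) F = eos_operator k F"
proof -
  let ?p = "2*k+1"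
  let ?H = "H0 k"
  have H_outside: "pdiff i ?H = 0" if "i \<noteq> k" "i \<noteq> k+1" "i \<noteq> k+2" "i \<noteq> ?p" for i
    using that by (simp add: H0_def derivation_simps)
  have H_p: "pdiff ?p ?H = 2 * z k * (z ?p - z k * z (k+1))"
    using assms(1) by (simp add: H0_def derivation_simps algebra_simps)
  have F_outside: "pdiff i F = 0" if "i < k \<or> i = 2*k" for i
    using that pdiff_outside[OF F] assms(1) by (auto simp: eos_vars_def)
  let ?t = "\<lambda>i. (pdiff i ?H + z (k+i) * pdiff ?p ?H) * pdiff (k+i) F
                 - (pdiff i F + z (k+i) * pdiff ?p F) * pdiff (k+i) ?H"
  have "{1..k} = insert k {1..<k}" using assms(1) by auto
  then have "sum ?t {1..k} = ?t k + sum ?t {1..<k}" by simp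
  also have "?t k = 0"
    using assms(1) F_outside[of "2*k"] H_outside[of "2*k"] by (simp flip: mult_2)
  also have "sum ?t {1..<k} =
      (\<Sum>i=1..<k. pdiff ?p ?H * (z (k+i) * pdiff (k+i) F) - pdiff ?p F * (z (k+i) * pdiff (k+i) ?H))"
    by (intro sum.cong) (auto simp: H_outside F_outside algebra_simps)
  also have "\<dots> = pdiff ?p ?H * conc_euler k F - pdiff ?p F * conc_euler k ?H"
    by (simp add: conc_euler_def sum_subtractf sum_distrib_left)
  finally have "contact_bracket k ?H F
      = pdiff ?p ?H * (conc_euler k F - F) + (?H - conc_euler k ?H) * pdiff ?p F"
    by (simp add: contact_bracket_def algebra_simps)
  also have "?H - conc_euler k ?H = z k * (z ?p^2 - (z k * z (k+1))^2) + 2 * z (k+2)^3"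
    using assms(1) by (simp add: H0_def derivation_simps algebra_simps)
  finally show ?thesis by (simp only: H_p eos_operator_def)
qed

lemma eos_operator_zero [simp]: "eos_operator k 0 = 0"
  by (simp add: eos_operator_def conc_euler_def)

lemma eos_operator_add: "eos_operator k (f + g) = eos_operator k f + eos_operator k g"
  by (simp add: eos_operator_def conc_euler_add pdiff_add algebra_simps)

lemma eos_operator_sum: "eos_operator k (\<Sum>i\<in>I. f i) = (\<Sum>i\<in>I. eos_operator k (f i))"
  by (induction I rule: infinite_finite_induct) (auto simp: eos_operator_add)

lemma eos_operator_mult_left:
  assumes "conc_euler k f = 0" "pdiff (2*k+1) f = 0"
  shows "eos_operator k (f * g) = f * eos_operator k g"
  using assms by (simp add: eos_operator_def conc_euler_mult pdiff_mult algebra_simps)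

lemma eos_operator_temp_power: "eos_operator k (z k ^ j * g) = z k ^ j * eos_operator k g"
proof (induction j)
  case (Suc j)
  have "eos_operator k (z k * (z k ^ j * g)) = z k * eos_operator k (z k ^ j * g)"
    by (rule eos_operator_mult_left) (simp_all add: conc_euler_z pdiff_z)
  with Suc show ?case by (simp add: mult.assoc)
qed simp

lemma eos_operator_scale:
  "eos_operator k (Poly_Mapping.single 0 c * g) = Poly_Mapping.single 0 c * eos_operator k g"
  by (rule eos_operator_mult_left) (simp_all add: conc_euler_const pdiff_const)

text \<open>In \<open>L ((p - x a)\<^sup>2)\<close> all terms with a factor \<open>x (p - x a)\<^sup>2\<close> cancel. Its leading monomial
  \<open>p b\<^sup>3\<close> is the exceptional one, not divisible by \<open>x\<close>.\<close>

lemma eos_operator_square: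
  assumes "k \<ge> 3"
  shows "eos_operator k ((z (2*k+1) - z k * z (k+1))^2)
    = 4 * z (k+2)^3 * (z (2*k+1) - z k * z (k+1))"
  using assms by (simp add: eos_operator_def derivation_simps algebra_simps)

text \<open>This kernel element makes \<open>x (p - x a)\<^sup>2\<close> and \<open>b\<^sup>3\<close> interchangeable as generating
  functions.\<close>

lemma eos_operator_H0:
  assumes "k \<ge> 3"
  shows "eos_operator k (H0 k) = 0"
  using assms by (simp add: eos_operator_def H0_def derivation_simps algebra_simps)

section \<open>Leading monomials of the image\<close>

lemma eos_lex_pressure:
  assumes "Poly_Mapping.lookup m (2*k+1) > Poly_Mapping.lookup n (2*k+1)"
  shows "eos_lex k m n"
  unfolding eos_lex_def lex_greater_def using assms by (intro exI[of _ 0]) auto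

lemma eos_lex_temp:
  assumes "k \<ge> 1" "Poly_Mapping.lookup m (2*k+1) = Poly_Mapping.lookup n (2*k+1)"
    and "Poly_Mapping.lookup m k > Poly_Mapping.lookup n k"
  shows "eos_lex k m n"
  unfolding eos_lex_def lex_greater_def using assms by (intro exI[of _ 1]) auto

lemma set_eos_variables:
  assumes "k \<ge> 1"
  shows "set ((2*k+1) # [k..<2*k]) = eos_vars k"
  using assms by (auto simp: eos_vars_def)

lemma is_leading_monom_unique:
  assumes "is_leading_monom (lex_greater vs) m f" "is_leading_monom (lex_greater vs) n f"
  shows "m = n"
proof (rule ccontr)
  assume "m \<noteq> n"
  with assms have "lex_greater vs m n" "lex_greater vs n m"
    by (simp_all add: is_leading_monom_def)
  then show False using lex_greater_asym by blast
qed

definition exponent_le :: "nat \<Rightarrow> nat \<Rightarrow> rpoly \<Rightarrow> bool" where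
  "exponent_le j N f \<longleftrightarrow> (\<forall>m\<in>Poly_Mapping.keys f. Poly_Mapping.lookup m j \<le> N)"

lemma exponent_le_single: "Poly_Mapping.lookup m j \<le> N \<Longrightarrow> exponent_le j N (Poly_Mapping.single m c)"
  by (simp add: exponent_le_def)

lemma exponent_le_z: "i \<noteq> j \<Longrightarrow> exponent_le j N (z i)"
  by (simp add: exponent_le_def z_def monom_poly_def lookup_single when_def)

lemma exponent_le_numeral: "exponent_le j N (numeral n)"
  using exponent_le_single[of 0 j N "numeral n"] by simp

lemma exponent_le_diff: "exponent_le j N f \<Longrightarrow> exponent_le j N g \<Longrightarrow> exponent_le j N (f - g)"
  using keys_diff[of f g] by (auto simp: exponent_le_def)

lemma exponent_le_mult:
  "exponent_le j 0 f \<Longrightarrow> exponent_le j N g \<Longrightarrow> exponent_le j N (f * g)"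
  using keys_mult[of f g] by (fastforce simp: exponent_le_def lookup_add)

lemma exponent_le_power: "exponent_le j 0 f \<Longrightarrow> exponent_le j 0 (f ^ n)"
proof (induction n)
  case 0
  show ?case by (simp add: exponent_le_def)
qed (auto intro: exponent_le_mult)

text \<open>The terms of \<open>L\<close> that raise the degree in \<open>p\<close> are \<open>2 x p (E - 1)\<close> and \<open>x p\<^sup>2 \<partial>\<^sub>p\<close>; both
  multiply a monomial by a constant times \<open>x p\<close>.\<close>

lemma eos_operator_single:
  fixes m :: monom and c :: real
  assumes "k \<ge> 3"
  defines "n \<equiv> Poly_Mapping.lookup m (2*k+1)"
  shows "exponent_le (2*k+1) n (eos_operator k (Poly_Mapping.single m c)
     - Poly_Mapping.single (m + Poly_Mapping.single k 1 + Poly_Mapping.single (2*k+1) 1)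
        ((2 * real (conc_degree k m) - 2 + real n) * c))"
proof -
  let ?p = "2*k+1"
  let ?F = "Poly_Mapping.single m c :: rpoly"
  let ?D = "conc_euler k ?F - ?F"
  let ?P = "pdiff ?p ?F"
  have D: "?D = Poly_Mapping.single m ((real (conc_degree k m) - 1) * c)"
    by (simp add: conc_euler_single algebra_simps flip: single_diff)
  have "z ?p * (z k * (2 * ?D + z ?p * ?P))
      = z ?p * (z k * Poly_Mapping.single m ((2 * real (conc_degree k m) - 2 + real n) * c))"
  proof -
    have "2 * ?D + z ?p * ?P
        = Poly_Mapping.single m ((2 * real (conc_degree k m) - 2 + real n) * c)"
      unfolding z_mult_pdiff_single D mult_2 n_def single_add[symmetric]
      by (rule arg_cong[where f = "Poly_Mapping.single m"]) (simp add: algebra_simps)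
    then show ?thesis by (rule arg_cong)
  qed
  also have "\<dots> = Poly_Mapping.single (m + Poly_Mapping.single k 1 + Poly_Mapping.single ?p 1)
        ((2 * real (conc_degree k m) - 2 + real n) * c)"
    by (simp only: z_mult_single)
  finally have "eos_operator k ?F
     - Poly_Mapping.single (m + Poly_Mapping.single k 1 + Poly_Mapping.single ?p 1)
        ((2 * real (conc_degree k m) - 2 + real n) * c)
     = (2 * z (k+2)^3 - z k ^ 3 * z (k+1)^2) * ?P - 2 * z k ^ 2 * z (k+1) * ?D"
    by (simp add: eos_operator_def power2_eq_square power3_eq_cube algebra_simps)
  moreover have "exponent_le ?p n ?D" "exponent_le ?p n ?P"
    unfolding D pdiff_single n_def
    by (auto intro: exponent_le_single simp: lookup_minus)
  ultimately show ?thesis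
    using assms(1)
    by (auto intro!: exponent_le_diff exponent_le_mult exponent_le_power exponent_le_z
        exponent_le_numeral)
qed

text \<open>The condition states that the coefficient \<open>2 d - 2 + n\<close> of the expected leading term
  does not vanish.\<close>

definition eos_regular :: "nat \<Rightarrow> monom \<Rightarrow> bool" where
  "eos_regular k m \<longleftrightarrow> m \<in> monoms_in (eos_vars k) \<and>
     2 * conc_degree k m + Poly_Mapping.lookup m (2*k+1) \<noteq> 2"

text \<open>The greatest monomial \<open>s\<close> of \<open>G\<close> also has the greatest degree in \<open>p\<close>, so the lower terms of all
  the \<open>L t\<close> stay below \<open>x p s\<close>, and translation invariance of the order takes care of the
  leading ones. The remainder \<open>S\<close> makes room for a multiple of \<open>L ((p - x a)\<^sup>2)\<close>.\<close>

lemma leading_monom_regular: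
  assumes k: "k \<ge> 3" and G: "G \<noteq> 0" "\<And>t. t \<in> Poly_Mapping.keys G \<Longrightarrow> eos_regular k t"
    and S: "\<And>s r. r \<in> Poly_Mapping.keys S \<Longrightarrow>
      eos_lex k (s + (Poly_Mapping.single k 1 + Poly_Mapping.single (2*k+1) 1)) r"
  obtains s where "s \<in> Poly_Mapping.keys G"
    "is_leading_monom (eos_lex k)
       (s + (Poly_Mapping.single k 1 + Poly_Mapping.single (2*k+1) 1)) (eos_operator k G + S)"
proof -
  let ?p = "2*k+1"
  let ?u = "Poly_Mapping.single k 1 + Poly_Mapping.single ?p 1 :: monom"
  let ?n = "\<lambda>t. Poly_Mapping.lookup t ?p"
  have "transp_on (Poly_Mapping.keys G) (eos_lex k)"
    using transp_lex_greater by (auto simp: eos_lex_def intro: transp_on_subset)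
  moreover have "totalp_on (Poly_Mapping.keys G) (eos_lex k)"
    unfolding eos_lex_def using k G(2) set_eos_variables[of k]
    by (intro totalp_onI lex_greater_total) (auto simp: eos_regular_def)
  ultimately obtain s where s: "s \<in> Poly_Mapping.keys G"
    and max: "\<And>t. t \<in> Poly_Mapping.keys G \<Longrightarrow> t \<noteq> s \<Longrightarrow> eos_lex k s t"
    using Finite_Set.bex_least_element[of "Poly_Mapping.keys G" "eos_lex k"] G(1) by auto
  have n_le: "?n t \<le> ?n s" if "t \<in> Poly_Mapping.keys G" for t
  proof (rule ccontr)
    assume "\<not> ?thesis"
    then have "eos_lex k t s" "t \<noteq> s" by (auto intro: eos_lex_pressure)
    with max[OF that] show False using lex_greater_asym unfolding eos_lex_def by blast
  qed
  define c where "c t = (2 * real (conc_degree k t) - 2 + real (?n t)) * Poly_Mapping.lookup G t" for t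
  define R where "R t = eos_operator k (Poly_Mapping.single t (Poly_Mapping.lookup G t))
      - Poly_Mapping.single (t + ?u) (c t)" for t
  have R: "?n r \<le> ?n s" if "t \<in> Poly_Mapping.keys G" "r \<in> Poly_Mapping.keys (R t)" for t r
    using eos_operator_single[OF k, of t "Poly_Mapping.lookup G t"] n_le[OF that(1)] that(2)
    unfolding exponent_le_def R_def c_def by (force simp: add.assoc)
  have top: "?n (s + ?u) = Suc (?n s)" using k by (simp add: lookup_add lookup_single when_def)
  have "eos_operator k G
      = eos_operator k (\<Sum>t\<in>Poly_Mapping.keys G. Poly_Mapping.single t (Poly_Mapping.lookup G t))"
    by (rule arg_cong[OF poly_mapping_eq_sum_single])
  then have image: "eos_operator k G
      = (\<Sum>t\<in>Poly_Mapping.keys G. Poly_Mapping.single (t + ?u) (c t) + R t)"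
    by (simp add: eos_operator_sum R_def)
  have "Poly_Mapping.lookup (Poly_Mapping.single (t + ?u) (c t) + R t) (s + ?u)
      = (if t = s then c s else 0)" if "t \<in> Poly_Mapping.keys G" for t
  proof -
    have "s + ?u \<notin> Poly_Mapping.keys (R t)" using R[OF that] top by fastforce
    then show ?thesis by (auto simp: lookup_add lookup_single when_def in_keys_iff)
  qed
  then have "Poly_Mapping.lookup (eos_operator k G) (s + ?u) = c s"
    using s by (simp add: image lookup_sum sum.delta cong: sum.cong)
  moreover have "s + ?u \<notin> Poly_Mapping.keys S"
    using S[of "s + ?u" s] lex_greater_irrefl by (auto simp: eos_lex_def)
  moreover have "c s \<noteq> 0"
  proof -
    have "real (2 * conc_degree k s + ?n s) \<noteq> real 2"
      using G(2)[OF s] unfolding eos_regular_def of_nat_eq_iff by blast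
    then show ?thesis using s by (simp add: c_def in_keys_iff)
  qed
  ultimately have mem: "s + ?u \<in> Poly_Mapping.keys (eos_operator k G + S)"
    by (simp add: in_keys_iff lookup_add)
  have "eos_lex k (s + ?u) r" if r: "r \<in> Poly_Mapping.keys (eos_operator k G + S)" "r \<noteq> s + ?u" for r
  proof (cases "r \<in> Poly_Mapping.keys S")
    case True
    then show ?thesis by (rule S)
  next
    case False
    with r(1) have "r \<in> Poly_Mapping.keys (eos_operator k G)"
      using keys_add[of "eos_operator k G" S] by blast
    then obtain t where t: "t \<in> Poly_Mapping.keys G"
      "r \<in> Poly_Mapping.keys (Poly_Mapping.single (t + ?u) (c t) + R t)"
      unfolding image by (blast dest: subsetD[OF keys_sum_subset])
    then have "r = t + ?u \<or> r \<in> Poly_Mapping.keys (R t)"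
      using keys_add[of "Poly_Mapping.single (t + ?u) (c t)" "R t"] by (auto split: if_splits)
    then show ?thesis
    proof
      assume "r = t + ?u"
      with r(2) max[OF t(1)] show ?thesis by (auto simp: eos_lex_def lex_greater_add_right)
    next
      assume "r \<in> Poly_Mapping.keys (R t)"
      with R[OF t(1)] top show ?thesis by (intro eos_lex_pressure) fastforce
    qed
  qed
  with mem s show ?thesis using that unfolding is_leading_monom_def by blast
qed

section \<open>Reduction modulo the kernel\<close>

lemma monoms_in_add: "m \<in> monoms_in V \<Longrightarrow> n \<in> monoms_in V \<Longrightarrow> m + n \<in> monoms_in V"
  using keys_add[of m n] by (auto simp: monoms_in_def)

lemma monoms_in_single: "i \<in> V \<Longrightarrow> Poly_Mapping.single i n \<in> monoms_in V"
  by (simp add: monoms_in_def)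

lemma eos_monom_eqI:
  assumes "m \<in> monoms_in (eos_vars k)" "n \<in> monoms_in (eos_vars k)"
    and "Poly_Mapping.lookup m (2*k+1) = Poly_Mapping.lookup n (2*k+1)"
    and "Poly_Mapping.lookup m k = Poly_Mapping.lookup n k"
    and "\<And>j. j \<in> {1..<k} \<Longrightarrow> Poly_Mapping.lookup m (k+j) = Poly_Mapping.lookup n (k+j)"
  shows "m = n"
proof (rule poly_mapping_eqI)
  fix l
  consider "l \<notin> eos_vars k" | "l = 2*k+1" | "l = k" | "l \<in> {k+1..<2*k}"
    by (force simp: eos_vars_def)
  then show "Poly_Mapping.lookup m l = Poly_Mapping.lookup n l"
  proof cases
    case 1
    then have "l \<notin> Poly_Mapping.keys m" "l \<notin> Poly_Mapping.keys n"
      using assms(1,2) by (auto simp: monoms_in_def)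
    then show ?thesis by (simp add: in_keys_iff)
  next
    case 4
    then have "l = k + (l - k)" "l - k \<in> {1..<k}" by auto
    then show ?thesis using assms(5) by metis
  qed (use assms(3,4) in simp_all)
qed

lemma eos_regular_product:
  assumes "k \<ge> 3" "2 * (b + e) + n \<noteq> 2"
  shows "Poly_Mapping.keys
     (Poly_Mapping.single 0 c * (z k ^ a * (z (k+1) ^ b * (z (k+2) ^ e * z (2*k+1) ^ n))))
     \<subseteq> Collect (eos_regular k)"
proof -
  let ?m = "Poly_Mapping.single k a + (Poly_Mapping.single (k+1) b +
      (Poly_Mapping.single (k+2) e + Poly_Mapping.single (2*k+1) n))"
  have "?m \<in> monoms_in (eos_vars k)"
    using assms(1) by (intro monoms_in_add monoms_in_single) (auto simp: eos_vars_def)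
  moreover have "conc_degree k ?m = b + e" "Poly_Mapping.lookup ?m (2*k+1) = n"
    using assms(1)
    by (simp_all add: conc_degree_add conc_degree_single lookup_add lookup_single when_def)
  ultimately have "eos_regular k ?m" using assms(2) by (simp only: eos_regular_def) simp
  then show ?thesis by (simp only: z_power monom_poly_def mult_single) simp
qed

text \<open>The reduction rests on two identities, with \<open>Q = (p - x a)\<^sup>2\<close>:
  \<open>p\<^sup>2 = Q + 2 x a p - x\<^sup>2 a\<^sup>2\<close> and \<open>x p\<^sup>2 = H\<^sub>0 + b\<^sup>3 + 2 x\<^sup>2 a p - x\<^sup>3 a\<^sup>2\<close>. The second is available
  for \<open>x\<^sup>j p\<^sup>2\<close> as soon as \<open>j > 0\<close>, which is why the multiples of \<open>Q\<close> have constant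
  coefficients.\<close>

lemma reduce_to_regular:
  assumes k: "k \<ge> 3" and F: "F \<in> polys_in (eos_vars k)"
  obtains G d where "Poly_Mapping.keys G \<subseteq> Collect (eos_regular k)"
    "eos_operator k F = eos_operator k G
       + Poly_Mapping.single 0 d * eos_operator k ((z (2*k+1) - z k * z (k+1))^2)"
proof -
  let ?p = "2*k+1"
  let ?Q = "(z ?p - z k * z (k+1))^2"
  define reducible where "reducible F \<longleftrightarrow>
    (\<exists>G d. Poly_Mapping.keys G \<subseteq> Collect (eos_regular k) \<and>
       eos_operator k F = eos_operator k G + Poly_Mapping.single 0 d * eos_operator k ?Q)" for F
  have keys: "Poly_Mapping.keys F \<subseteq> monoms_in (eos_vars k)"
    using F by (simp add: polys_in_def)
  have "reducible F"
    using keys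
  proof (induction F rule: poly_mapping_additive_induct)
    case zero
    show ?case unfolding reducible_def by (intro exI[of _ 0]) simp
  next
    case (add f g)
    then obtain G d G' d' where
      "Poly_Mapping.keys G \<subseteq> Collect (eos_regular k)" "Poly_Mapping.keys G' \<subseteq> Collect (eos_regular k)"
      "eos_operator k f = eos_operator k G + Poly_Mapping.single 0 d * eos_operator k ?Q"
      "eos_operator k g = eos_operator k G' + Poly_Mapping.single 0 d' * eos_operator k ?Q"
      unfolding reducible_def by blast
    then show ?case
      unfolding reducible_def using keys_add[of G G']
      by (intro exI[of _ "G + G'"] exI[of _ "d + d'"])
        (auto simp: eos_operator_add single_add distrib_right)
  next
    case (single m c)
    let ?C = "Poly_Mapping.single 0 c :: rpoly"
    have "2 * conc_degree k m + Poly_Mapping.lookup m ?p = 2 \<longleftrightarrow>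
        (conc_degree k m = 1 \<and> Poly_Mapping.lookup m ?p = 0)
        \<or> (conc_degree k m = 0 \<and> Poly_Mapping.lookup m ?p = 2)"
      by presburger
    with single have "eos_regular k m
        \<or> (conc_degree k m = 1 \<and> Poly_Mapping.lookup m ?p = 0)
        \<or> (conc_degree k m = 0 \<and> Poly_Mapping.lookup m ?p = 2)"
      by (auto simp: eos_regular_def)
    then show ?case
    proof (elim disjE conjE)
      assume "eos_regular k m"
      then show ?thesis unfolding reducible_def
        by (intro exI[of _ "Poly_Mapping.single m c"] exI[of _ 0]) simp
    next
      assume "conc_degree k m = 1" "Poly_Mapping.lookup m ?p = 0"
      then have "eos_operator k (Poly_Mapping.single m c) = 0"
        by (simp add: eos_operator_def conc_euler_single pdiff_single)
      then show ?thesis unfolding reducible_def by (intro exI[of _ 0]) simp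
    next
      assume exps: "conc_degree k m = 0" "Poly_Mapping.lookup m ?p = 2"
      define j where "j = Poly_Mapping.lookup m k"
      have "m = Poly_Mapping.single k j + Poly_Mapping.single ?p 2"
      proof (rule eos_monom_eqI)
        show "Poly_Mapping.single k j + Poly_Mapping.single ?p 2 \<in> monoms_in (eos_vars k)"
          using k by (intro monoms_in_add monoms_in_single) (auto simp: eos_vars_def)
      qed (use single exps in \<open>auto simp: j_def lookup_add lookup_single when_def conc_degree_def\<close>)
      then have m: "Poly_Mapping.single m c = ?C * (z k ^ j * z ?p ^ 2)"
        by (simp add: z_power monom_poly_def mult_single)
      have two: "Poly_Mapping.single 0 (2 * c) = 2 * ?C"
        by (simp only: mult_2 single_add)
      show ?thesis
      proof (cases j)
        case 0
        define G where "G =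
            Poly_Mapping.single 0 (2 * c) * (z k ^ 1 * (z (k+1) ^ 1 * (z (k+2) ^ 0 * z ?p ^ 1)))
          - ?C * (z k ^ 2 * (z (k+1) ^ 2 * (z (k+2) ^ 0 * z ?p ^ 0)))"
        have "Poly_Mapping.keys G \<subseteq> Collect (eos_regular k)"
          unfolding G_def
          by (intro order_trans[OF keys_diff] Un_least eos_regular_product k) simp_all
        moreover have "Poly_Mapping.single m c = G + ?C * ?Q"
          unfolding m G_def two 0 by (simp add: power2_eq_square algebra_simps)
        ultimately show ?thesis unfolding reducible_def
          by (intro exI[of _ G] exI[of _ c]) (simp only: eos_operator_add eos_operator_scale simp_thms)
      next
        case (Suc i)
        define G where "G =
            Poly_Mapping.single 0 (2 * c) * (z k ^ (i+2) * (z (k+1) ^ 1 * (z (k+2) ^ 0 * z ?p ^ 1)))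
          - ?C * (z k ^ (i+3) * (z (k+1) ^ 2 * (z (k+2) ^ 0 * z ?p ^ 0)))
          + ?C * (z k ^ i * (z (k+1) ^ 0 * (z (k+2) ^ 3 * z ?p ^ 0)))"
        have "Poly_Mapping.keys G \<subseteq> Collect (eos_regular k)"
          unfolding G_def
          by (intro order_trans[OF keys_add] order_trans[OF keys_diff] Un_least
              eos_regular_product k) simp_all
        moreover have "Poly_Mapping.single m c = G + ?C * (z k ^ i * H0 k)"
          unfolding m G_def two Suc H0_def
          by (simp add: power2_eq_square power3_eq_cube power_add algebra_simps)
        then have "eos_operator k (Poly_Mapping.single m c) = eos_operator k G"
          by (simp add: eos_operator_add eos_operator_scale eos_operator_temp_power
              eos_operator_H0 k)
        ultimately show ?thesis unfolding reducible_def
          by (intro exI[of _ G] exI[of _ 0]) simp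
      qed
    qed
  qed
  then show ?thesis using that unfolding reducible_def by blast
qed

section \<open>Classification of the leading monomials\<close>

lemma polys_in_z: "i \<in> V \<Longrightarrow> z i \<in> polys_in V"
  by (simp add: polys_in_def z_def monom_poly_def monoms_in_def)

lemma polys_in_diff: "f \<in> polys_in V \<Longrightarrow> g \<in> polys_in V \<Longrightarrow> f - g \<in> polys_in V"
  using keys_diff[of f g] by (auto simp: polys_in_def)

lemma polys_in_mult: "f \<in> polys_in V \<Longrightarrow> g \<in> polys_in V \<Longrightarrow> f * g \<in> polys_in V"
  using keys_mult[of f g] monoms_in_add by (fastforce simp: polys_in_def)

text \<open>Multiplication by \<open>x p\<close> raises the degree in \<open>p\<close> by one, which turns the excluded value
  \<open>2\<close> of \<open>2 d + n\<close> into \<open>3\<close>.\<close>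

lemma regular_shift_iff:
  fixes m :: monom
  assumes k: "k \<ge> 3"
  shows "(\<exists>s. eos_regular k s \<and> m = s + (Poly_Mapping.single k 1 + Poly_Mapping.single (2*k+1) 1))
    \<longleftrightarrow> m \<in> monoms_in (eos_vars k) \<and> Poly_Mapping.lookup m k \<ge> 1 \<and>
        Poly_Mapping.lookup m (2*k+1) \<ge> 1 \<and> 2 * conc_degree k m + Poly_Mapping.lookup m (2*k+1) \<noteq> 3"
    (is "?L \<longleftrightarrow> ?R")
proof
  let ?u = "Poly_Mapping.single k 1 + Poly_Mapping.single (2*k+1) 1 :: monom"
  have u: "conc_degree k ?u = 0" "Poly_Mapping.lookup ?u (2*k+1) = 1" "Poly_Mapping.lookup ?u k = 1"
    using k by (simp_all add: conc_degree_add conc_degree_single lookup_add lookup_single when_def)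
  {
    assume ?L
    then obtain s where s: "eos_regular k s" "m = s + ?u" by blast
    have "?u \<in> monoms_in (eos_vars k)"
      using k by (intro monoms_in_add monoms_in_single) (auto simp: eos_vars_def)
    with s(1) have "s + ?u \<in> monoms_in (eos_vars k)"
      by (auto simp: eos_regular_def intro: monoms_in_add)
    moreover have "conc_degree k (s + ?u) = conc_degree k s"
      "Poly_Mapping.lookup (s + ?u) (2*k+1) = Poly_Mapping.lookup s (2*k+1) + 1"
      "Poly_Mapping.lookup (s + ?u) k = Poly_Mapping.lookup s k + 1"
      by (simp_all only: conc_degree_add[of k s] lookup_add[of s] u add_0_right)
    ultimately show ?R
      using s(1) unfolding s(2) eos_regular_def by linarith
  next
    assume R: ?R
    have m: "m = (m - ?u) + ?u"
      using R by (intro poly_mapping_eqI) (auto simp: lookup_add lookup_minus lookup_single when_def)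
    have "conc_degree k m = conc_degree k (m - ?u)"
      "Poly_Mapping.lookup m (2*k+1) = Poly_Mapping.lookup (m - ?u) (2*k+1) + 1"
      by (subst m, simp only: conc_degree_add[of k "m - ?u"] lookup_add[of "m - ?u"] u add_0_right)+
    moreover have "m - ?u \<in> monoms_in (eos_vars k)"
      using R by (auto simp: monoms_in_def in_keys_iff lookup_minus)
    ultimately have "eos_regular k (m - ?u)"
      using R by (auto simp: eos_regular_def)
    with m show ?L by blast
  }
qed

text \<open>For \<open>G \<noteq> 0\<close> the leading monomial of \<open>L G + c L Q\<close> comes from \<open>L G\<close>; only for \<open>G = 0\<close> does
  \<open>p b\<^sup>3\<close> show up. The monomials \<open>?P\<close> and \<open>?X\<close> in the proof are the two terms \<open>p b\<^sup>3\<close> and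
  \<open>x a b\<^sup>3\<close> of \<open>L Q / 4\<close>.\<close>

lemma leading_monom_image_iff:
  fixes m :: monom
  assumes k: "k \<ge> 3"
  shows "(\<exists>F\<in>polys_in (eos_vars k). contact_bracket k (H0 k) F \<noteq> 0 \<and>
            is_leading_monom (eos_lex k) m (contact_bracket k (H0 k) F))
    \<longleftrightarrow> (m \<in> monoms_in (eos_vars k) \<and> Poly_Mapping.lookup m k \<ge> 1 \<and>
          Poly_Mapping.lookup m (2*k+1) \<ge> 1 \<and>
          2 * conc_degree k m + Poly_Mapping.lookup m (2*k+1) \<noteq> 3)
        \<or> m = Poly_Mapping.single (2*k+1) 1 + Poly_Mapping.single (k+2) 3"
    (is "?L \<longleftrightarrow> ?R \<or> m = ?P")
proof -
  let ?p = "2*k+1"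
  let ?u = "Poly_Mapping.single k 1 + Poly_Mapping.single ?p 1 :: monom"
  let ?X = "Poly_Mapping.single k 1 + Poly_Mapping.single (k+1) 1 + Poly_Mapping.single (k+2) 3 :: monom"
  let ?Q = "(z ?p - z k * z (k+1))^2"
  define S where "S d = Poly_Mapping.single ?P (4 * d) - Poly_Mapping.single ?X (4 * d)" for d :: real
  have "4 * z (k+2)^3 * (z ?p - z k * z (k+1))
      = Poly_Mapping.single 0 4 * (monom_poly ?P - monom_poly ?X)"
    by (simp only: monom_poly_add z_power[symmetric] single_numeral) (simp add: algebra_simps)
  then have S: "Poly_Mapping.single 0 d * eos_operator k ?Q = S d" for d
    unfolding eos_operator_square[OF k] S_def
    by (simp only: monom_poly_def right_diff_distrib mult_single) (simp add: mult.commute)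
  have keys_S: "Poly_Mapping.keys (S d) \<subseteq> {?P, ?X}" for d
    unfolding S_def using keys_diff by (fastforce split: if_splits)
  have exps: "Poly_Mapping.lookup ?P ?p = 1" "Poly_Mapping.lookup ?P k = 0"
    "Poly_Mapping.lookup ?X ?p = 0"
    using k by (simp_all add: lookup_add lookup_single when_def)
  have PX: "eos_lex k ?P ?X"
    by (rule eos_lex_pressure) (simp only: exps)
  have S_small: "eos_lex k (s + ?u) r" if "r \<in> Poly_Mapping.keys (S d)" for r s d
  proof -
    have s: "Poly_Mapping.lookup (s + ?u) ?p \<ge> 1" "Poly_Mapping.lookup (s + ?u) k \<ge> 1"
      using k by (simp_all add: lookup_add lookup_single when_def)
    have "eos_lex k (s + ?u) ?X"
      using s by (intro eos_lex_pressure) (simp only: exps)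
    moreover have "eos_lex k (s + ?u) ?P"
    proof (cases "Poly_Mapping.lookup (s + ?u) ?p = 1")
      case True
      then show ?thesis using s k by (intro eos_lex_temp) (simp_all only: exps)
    next
      case False
      then show ?thesis using s by (intro eos_lex_pressure) (simp only: exps)
    qed
    ultimately show ?thesis using keys_S that by blast
  qed
  have lead_S: "is_leading_monom (eos_lex k) ?P (S d)" if "d \<noteq> 0" for d
  proof -
    have "?P \<noteq> ?X" using arg_cong[of ?P ?X "\<lambda>m. Poly_Mapping.lookup m ?p"] exps by linarith
    then have "Poly_Mapping.lookup (S d) ?P = 4 * d"
      by (simp only: S_def lookup_minus lookup_single when_def) simp
    then have "?P \<in> Poly_Mapping.keys (S d)"
      using that by (simp add: in_keys_iff)
    with keys_S PX show ?thesis unfolding is_leading_monom_def by blast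
  qed
  have lead_nonzero: "f \<noteq> 0" if "is_leading_monom (eos_lex k) n f" for n f
    using that by (auto simp: is_leading_monom_def)
  have "?L \<longleftrightarrow> (\<exists>s. eos_regular k s \<and> m = s + ?u) \<or> m = ?P"
  proof
    assume ?L
    then obtain F where F: "F \<in> polys_in (eos_vars k)"
      and m: "is_leading_monom (eos_lex k) m (eos_operator k F)"
      using contact_bracket_H0[OF k] by auto
    from reduce_to_regular[OF k F] obtain G d where
      G: "Poly_Mapping.keys G \<subseteq> Collect (eos_regular k)" "eos_operator k F = eos_operator k G + S d"
      unfolding S by metis
    show "(\<exists>s. eos_regular k s \<and> m = s + ?u) \<or> m = ?P"
    proof (cases "G = 0")
      case True
      then have "is_leading_monom (eos_lex k) m (S d)" using m G(2) by simp
      moreover from this have "d \<noteq> 0" by (auto simp: S_def is_leading_monom_def)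
      ultimately show ?thesis
        using lead_S[of d] is_leading_monom_unique unfolding eos_lex_def by blast
    next
      case False
      have "\<And>t. t \<in> Poly_Mapping.keys G \<Longrightarrow> eos_regular k t" using G(1) by auto
      from leading_monom_regular[OF k False this S_small[of _ d]]
      obtain s where s: "s \<in> Poly_Mapping.keys G"
        "is_leading_monom (eos_lex k) (s + ?u) (eos_operator k F)"
        unfolding G(2) by blast
      then have "m = s + ?u" using m is_leading_monom_unique unfolding eos_lex_def by blast
      with s(1) G(1) show ?thesis by blast
    qed
  next
    assume "(\<exists>s. eos_regular k s \<and> m = s + ?u) \<or> m = ?P"
    then obtain F where "F \<in> polys_in (eos_vars k)" "is_leading_monom (eos_lex k) m (eos_operator k F)"
    proof (elim disjE exE conjE)
      fix s assume s: "eos_regular k s" "m = s + ?u"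
      let ?F = "Poly_Mapping.single s 1 :: rpoly"
      have "?F \<noteq> 0" by (metis lookup_single_eq lookup_zero zero_neq_one)
      moreover have "\<And>t. t \<in> Poly_Mapping.keys ?F \<Longrightarrow> eos_regular k t" using s(1) by simp
      ultimately obtain t where "t \<in> Poly_Mapping.keys ?F"
        "is_leading_monom (eos_lex k) (t + ?u) (eos_operator k ?F + 0)"
        using leading_monom_regular[OF k, of ?F 0] by auto
      moreover have "?F \<in> polys_in (eos_vars k)"
        using s(1) by (simp add: polys_in_def eos_regular_def)
      ultimately show ?thesis using that[of ?F] s(2) by simp
    next
      assume P: "m = ?P"
      have "?Q \<in> polys_in (eos_vars k)"
        unfolding power2_eq_square using k
        by (intro polys_in_mult polys_in_diff polys_in_z) (auto simp: eos_vars_def)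
      then show ?thesis using that[of ?Q] lead_S[of 1] S[of 1] unfolding P by simp
    qed
    then show ?L using contact_bracket_H0[OF k] lead_nonzero by metis
  qed
  then show ?thesis unfolding regular_shift_iff[OF k] .
qed

lemma minimal_resonant_set_H0:
  assumes k: "k \<ge> 3"
  shows "minimal_resonant_set k (eos_lex k) (H0 k) = {monom_poly m | m.
    m \<in> monoms_in (eos_vars k) \<and> m \<noteq> Poly_Mapping.single (2*k+1) 1 + Poly_Mapping.single (k+2) 3 \<and>
    (Poly_Mapping.lookup m k = 0 \<or> Poly_Mapping.lookup m (2*k+1) = 0 \<or>
     2 * conc_degree k m + Poly_Mapping.lookup m (2*k+1) = 3)}"
  unfolding minimal_resonant_set_def leading_monom_image_iff[OF k]
  by (intro Collect_cong) (auto simp: not_le)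

lemma monom_poly_eos_eq_prod:
  assumes "k \<ge> 3" "m \<in> monoms_in (eos_vars k)"
  shows "monom_poly m = z (2*k+1) ^ Poly_Mapping.lookup m (2*k+1) * (z k ^ Poly_Mapping.lookup m k *
    (\<Prod>l=k+1..2*k-1. z l ^ Poly_Mapping.lookup m l))"
proof -
  have V: "eos_vars k = insert (2*k+1) (insert k {k+1..2*k-1})"
    using assms(1) by (auto simp: eos_vars_def)
  have "finite (eos_vars k)" by (simp add: V)
  from monom_poly_eq_prod[OF this assms(2)] show ?thesis
    using assms(1) by (simp add: V)
qed

theorem theorem4:
  fixes k :: nat
  assumes "k \<ge> 3"
  shows "minimal_resonant_set k (eos_lex k) (H0 k) =
      {z k ^ i k * (\<Prod>l=k+1..2*k-1. z l ^ i l) | i :: nat \<Rightarrow> nat. True}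
    \<union> {z (2*k+1) * z k ^ (ik + 1) * z (k+j) | ik j :: nat. j \<in> {1..k-1}}
    \<union> {z (2*k+1) ^ 3 * z k ^ (ik + 1) | ik :: nat. True}
    \<union> ({z (2*k+1) ^ i (2*k+1) * (\<Prod>l=k+1..2*k-1. z l ^ i l) | i :: nat \<Rightarrow> nat. True}
        - {z (2*k+1) * z (k+2) ^ 3})"
    (is "_ = ?A \<union> ?B1 \<union> ?B3 \<union> (?C - {?e})")
proof -
  let ?p = "2*k+1"
  let ?M = "monoms_in (eos_vars k)"
  let ?P = "Poly_Mapping.single ?p 1 + Poly_Mapping.single (k+2) 3 :: monom"
  have single_mem: "Poly_Mapping.single l n \<in> ?M" if "l = ?p \<or> l \<in> {k..<2*k}" for l n
    using that by (intro monoms_in_single) (auto simp: eos_vars_def)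
  have A: "?A = {monom_poly m | m. m \<in> ?M \<and> Poly_Mapping.lookup m ?p = 0}"
  proof (intro equalityI subsetI)
    fix f assume "f \<in> ?A"
    then obtain i where f: "f = z k ^ i k * (\<Prod>l=k+1..2*k-1. z l ^ i l)" by blast
    obtain m where m: "m \<in> monoms_in {k..2*k-1}" "(\<Prod>l\<in>{k..2*k-1}. z l ^ i l) = monom_poly m"
      "\<And>l. Poly_Mapping.lookup m l = (if l \<in> {k..2*k-1} then i l else 0)"
      using prod_eq_monom_poly[of "{k..2*k-1}" i] by blast
    have "{k..2*k-1} = insert k {k+1..2*k-1}" using assms by auto
    then have "f = monom_poly m" using m(2) f by simp
    moreover have "m \<in> ?M" using m(1) by (auto simp: monoms_in_def eos_vars_def)
    moreover have "Poly_Mapping.lookup m ?p = 0"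
    proof -
      have "\<not> ?p \<le> 2*k-1" by arith
      then show ?thesis by (simp add: m(3))
    qed
    ultimately show "f \<in> {monom_poly m | m. m \<in> ?M \<and> Poly_Mapping.lookup m ?p = 0}" by blast
  next
    fix f assume "f \<in> {monom_poly m | m. m \<in> ?M \<and> Poly_Mapping.lookup m ?p = 0}"
    then obtain m where "m \<in> ?M" "Poly_Mapping.lookup m ?p = 0" "f = monom_poly m" by blast
    then have "f = z k ^ Poly_Mapping.lookup m k * (\<Prod>l=k+1..2*k-1. z l ^ Poly_Mapping.lookup m l)"
      by (simp only: monom_poly_eos_eq_prod[OF assms] power_0 mult_1_left)
    then show "f \<in> ?A" by blast
  qed
  have C: "?C = {monom_poly m | m. m \<in> ?M \<and> Poly_Mapping.lookup m k = 0}"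
  proof (intro equalityI subsetI)
    fix f assume "f \<in> ?C"
    then obtain i where f: "f = z ?p ^ i ?p * (\<Prod>l=k+1..2*k-1. z l ^ i l)" by blast
    let ?V = "insert ?p {k+1..2*k-1}"
    obtain m where m: "m \<in> monoms_in ?V" "(\<Prod>l\<in>?V. z l ^ i l) = monom_poly m"
      "\<And>l. Poly_Mapping.lookup m l = (if l \<in> ?V then i l else 0)"
      using prod_eq_monom_poly[of ?V i] by blast
    have "f = monom_poly m" unfolding m(2)[symmetric] f using assms by (subst prod.insert) auto
    moreover have "m \<in> ?M" using m(1) by (auto simp: monoms_in_def eos_vars_def)
    ultimately show "f \<in> {monom_poly m | m. m \<in> ?M \<and> Poly_Mapping.lookup m k = 0}"
      using m(3)[of k] assms by auto
  next
    fix f assume "f \<in> {monom_poly m | m. m \<in> ?M \<and> Poly_Mapping.lookup m k = 0}"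
    then obtain m where "m \<in> ?M" "Poly_Mapping.lookup m k = 0" "f = monom_poly m" by blast
    then have "f = z ?p ^ Poly_Mapping.lookup m ?p * (\<Prod>l=k+1..2*k-1. z l ^ Poly_Mapping.lookup m l)"
      by (simp only: monom_poly_eos_eq_prod[OF assms] power_0 mult_1_left)
    then show "f \<in> ?C" by blast
  qed
  have B1: "?B1 = {monom_poly m | m. m \<in> ?M \<and> Poly_Mapping.lookup m k \<noteq> 0 \<and>
      Poly_Mapping.lookup m ?p = 1 \<and> conc_degree k m = 1}"
  proof -
    let ?m = "\<lambda>a j. Poly_Mapping.single ?p 1 + Poly_Mapping.single k (a+1) + Poly_Mapping.single (k+j) 1 :: monom"
    have prod: "z ?p * z k ^ (a+1) * z (k+j) = monom_poly (?m a j)" for a j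
      by (simp only: monom_poly_add z_power[symmetric] power_one_right)
    have mem: "?m a j \<in> ?M" if "j \<in> {1..k-1}" for a j
      using that by (intro monoms_in_add single_mem) auto
    have props: "Poly_Mapping.lookup (?m a j) k = a + 1" "Poly_Mapping.lookup (?m a j) ?p = 1"
      "conc_degree k (?m a j) = 1" if "j \<in> {1..k-1}" for a j
      using that by (auto simp: lookup_add lookup_single when_def conc_degree_add conc_degree_single)
    have shape: "\<exists>a j. j \<in> {1..k-1} \<and> m = ?m a j" if m: "m \<in> ?M" "Poly_Mapping.lookup m k \<noteq> 0"
      "Poly_Mapping.lookup m ?p = 1" "conc_degree k m = 1" for m
    proof -
      obtain j where j: "j \<in> {1..<k}" "Poly_Mapping.lookup m (k+j) = 1"
        "\<And>l. l \<in> {1..<k} \<Longrightarrow> j \<noteq> l \<Longrightarrow> Poly_Mapping.lookup m (k+l) = 0"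
        using m(4) unfolding conc_degree_def by (subst (asm) sum_eq_1_iff) auto
      then have j': "j \<in> {1..k-1}" by auto
      have "m = ?m (Poly_Mapping.lookup m k - 1) j"
        by (rule eos_monom_eqI[OF m(1) mem[OF j']])
          (use m(2,3) j in \<open>auto simp: lookup_add lookup_single when_def\<close>)
      with j' show ?thesis by blast
    qed
    show ?thesis
    proof (intro equalityI subsetI)
      fix f assume "f \<in> ?B1"
      then obtain a j where "j \<in> {1..k-1}" "f = monom_poly (?m a j)" unfolding prod by blast
      with mem props show "f \<in> {monom_poly m | m. m \<in> ?M \<and> Poly_Mapping.lookup m k \<noteq> 0 \<and>
          Poly_Mapping.lookup m ?p = 1 \<and> conc_degree k m = 1}"
        by (intro CollectI exI[of _ "?m a j"]) simp
    next
      fix f assume "f \<in> {monom_poly m | m. m \<in> ?M \<and> Poly_Mapping.lookup m k \<noteq> 0 \<and>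
          Poly_Mapping.lookup m ?p = 1 \<and> conc_degree k m = 1}"
      then show "f \<in> ?B1" unfolding prod using shape by blast
    qed
  qed
  have B3: "?B3 = {monom_poly m | m. m \<in> ?M \<and> Poly_Mapping.lookup m k \<noteq> 0 \<and>
      Poly_Mapping.lookup m ?p = 3 \<and> conc_degree k m = 0}"
  proof -
    let ?m = "\<lambda>a. Poly_Mapping.single ?p 3 + Poly_Mapping.single k (a+1) :: monom"
    have prod: "z ?p ^ 3 * z k ^ (a+1) = monom_poly (?m a)" for a
      by (simp only: monom_poly_add z_power)
    have mem: "?m a \<in> ?M" for a
      using assms by (intro monoms_in_add single_mem) auto
    have props: "Poly_Mapping.lookup (?m a) k = a + 1" "Poly_Mapping.lookup (?m a) ?p = 3"
      "conc_degree k (?m a) = 0" for a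
      using assms by (auto simp: lookup_add lookup_single when_def conc_degree_add conc_degree_single)
    have shape: "\<exists>a. m = ?m a" if m: "m \<in> ?M" "Poly_Mapping.lookup m k \<noteq> 0"
      "Poly_Mapping.lookup m ?p = 3" "conc_degree k m = 0" for m
    proof
      show "m = ?m (Poly_Mapping.lookup m k - 1)"
        by (rule eos_monom_eqI[OF m(1) mem])
          (use m assms in \<open>auto simp: lookup_add lookup_single when_def conc_degree_def\<close>)
    qed
    show ?thesis
    proof (intro equalityI subsetI)
      fix f assume "f \<in> ?B3"
      then obtain a where "f = monom_poly (?m a)" unfolding prod by blast
      with mem props show "f \<in> {monom_poly m | m. m \<in> ?M \<and> Poly_Mapping.lookup m k \<noteq> 0 \<and>
          Poly_Mapping.lookup m ?p = 3 \<and> conc_degree k m = 0}"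
        by (intro CollectI exI[of _ "?m a"]) simp
    next
      fix f assume "f \<in> {monom_poly m | m. m \<in> ?M \<and> Poly_Mapping.lookup m k \<noteq> 0 \<and>
          Poly_Mapping.lookup m ?p = 3 \<and> conc_degree k m = 0}"
      then show "f \<in> ?B3" unfolding prod using shape by blast
    qed
  qed
  have e: "?e = monom_poly ?P"
    by (simp only: monom_poly_add z_power[symmetric] power_one_right)
  have "Poly_Mapping.lookup ?P ?p = 1" "conc_degree k ?P = 3"
    using assms by (simp_all add: lookup_add lookup_single when_def conc_degree_add conc_degree_single)
  then have P: "m \<noteq> ?P" if "Poly_Mapping.lookup m ?p = 0 \<or> conc_degree k m \<le> 1" for m
    using that by auto
  \<comment> \<open>\<open>2 d + n = 3\<close> has the solutions \<open>(d, n) = (1, 1)\<close> and \<open>(0, 3)\<close>, which are the two families of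
    resonant monomials divisible by \<open>x p\<close>.\<close>
  have cond: "m \<noteq> ?P \<and> (Poly_Mapping.lookup m k = 0 \<or> Poly_Mapping.lookup m ?p = 0 \<or>
        2 * conc_degree k m + Poly_Mapping.lookup m ?p = 3)
    \<longleftrightarrow> Poly_Mapping.lookup m ?p = 0
      \<or> (Poly_Mapping.lookup m k \<noteq> 0 \<and> Poly_Mapping.lookup m ?p = 1 \<and> conc_degree k m = 1)
      \<or> (Poly_Mapping.lookup m k \<noteq> 0 \<and> Poly_Mapping.lookup m ?p = 3 \<and> conc_degree k m = 0)
      \<or> (Poly_Mapping.lookup m k = 0 \<and> m \<noteq> ?P)" for m
  proof -
    have "2 * conc_degree k m + Poly_Mapping.lookup m ?p = 3 \<longleftrightarrow>
        (Poly_Mapping.lookup m ?p = 1 \<and> conc_degree k m = 1)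
        \<or> (Poly_Mapping.lookup m ?p = 3 \<and> conc_degree k m = 0)"
      by presburger
    then show ?thesis using P[of m] by auto
  qed
  show ?thesis
    unfolding minimal_resonant_set_H0[OF assms] A B1 B3 C e cond
    by (rule set_eqI) (auto simp: monom_poly_inject)
qed

end
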